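(* Let $\Lambda = \{\lambda_{1}, \lambda_{2}, \dots\}\subset \mathbb{Z}^{+}$ be an infinite set with $1\le \lambda_{1} < \lambda_{2} < \dots$ and let $A = \{a_{1}, a_{2}, \dots\}\subset \mathbb{N}$ be an infinite set with $0\le a_{1} < a_{2} < \dots$. Then the following are equivalent: (a) for every $n\in \mathbb{N}$ there exists a unique infinite vector of positive integers $(i_{n,1}, i_{n,2}, \dots)$ such that \[ n = \sum_{j=1}^{\infty}\lambda_{j}a_{i_{n,j}}; \] (b) there exist an integer $\lambda \ge 2$ and an infinite sequence of integers $u_{1}, v_{1}, u_{2}, v_{2}, \dots \ge 2$ such that \[ \Lambda = \Lambda_{\lambda}(u_{1}, v_{1}, u_{2}, v_{2}, \dots) \quad\text{and}\quad A = A_{\lambda}(u_{1}, v_{1}, u_{2}, v_{2}, \dots). \]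
   Context: $\mathbb{N}$ is the set of nonnegative integers and $\mathbb{Z}^{+}$ the set of positive integers. For positive integers $u_1,v_1,u_2,v_2,\dots$ put $U_i=u_1u_2\cdots u_i$, $V_i=v_1v_2\cdots v_i$ (with $U_0=V_0=1$). For $k\ge 1$ define \[ S(u_{1}, v_{1}, \dots ,u_{k-1}, v_{k-1}, u_{k}) = \Big\{\sum_{h=0}^{k-1} i_h U_hV_h: 0\le i_{h} < u_{h+1},\ h = 0,1, \dots ,k-1\Big\}, \] \[ T(u_{1}, v_{1}, \dots ,u_{k}, v_{k}) = \Big\{\sum_{h=0}^{k-1} j_h U_{h+1}V_h: 0\le j_{h} < v_{h+1},\ h = 0,1, \dots ,k-1\Big\}, \] where all $i_h,j_h$ are integers, and for infinite sequences \[ S(u_{1}, v_{1}, u_{2}, v_{2}, \dots) = \bigcup_{k=1}^{\infty}S(u_{1}, v_{1}, \dots ,u_{k-1}, v_{k-1}, u_{k}),\qquad T(u_{1}, v_{1}, u_{2}, v_{2}, \dots) = \bigcup_{k=1}^{\infty}T(u_{1}, v_{1}, \dots ,u_{k}, v_{k}). \] For an integer $\lambda\ge 2$ define \[ \Lambda_{\lambda}(u_{1}, v_{1}, u_{2}, v_{2}, \dots) = \{\lambda^{s}: s\in S(u_{1}, v_{1}, u_{2}, v_{2}, \dots)\}, \] \[ A_{\lambda}(u_{1}, v_{1}, u_{2}, v_{2}, \dots) = \Big\{\sum_{t\in T(u_{1}, v_{1}, u_{2}, v_{2}, \dots)}\delta_{t}\lambda^{t}: 0\le \delta_{t} < \lambda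 \Big\}, \] where the $\delta_t$ are integers, only finitely many of which are nonzero. *)

theory Defs
  imports Complex_Main "HOL-Library.Infinite_Set"
begin

text \<open>
  The sequences \<open>u\<close> and \<open>v\<close> are indexed from 1; their values at 0 are never used.
\<close>

definition initial_prod :: "(nat \<Rightarrow> nat) \<Rightarrow> nat \<Rightarrow> nat" where
  "initial_prod u i = (\<Prod>h=1..i. u h)"

text \<open>
  \<open>S_fin u v k\<close> is \<open>S(u\<^sub>1, v\<^sub>1, \<dots>, u\<^bsub>k-1\<^esub>, v\<^bsub>k-1\<^esub>, u\<^sub>k)\<close> and
  \<open>T_fin u v k\<close> is \<open>T(u\<^sub>1, v\<^sub>1, \<dots>, u\<^sub>k, v\<^sub>k)\<close>.
\<close>

definition S_fin :: "(nat \<Rightarrow> nat) \<Rightarrow> (nat \<Rightarrow> nat) \<Rightarrow> nat \<Rightarrow> nat set" where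
  "S_fin u v k =
     {\<Sum>h<k. i h * initial_prod u h * initial_prod v h | i. \<forall>h<k. i h < u (h + 1)}"

definition T_fin :: "(nat \<Rightarrow> nat) \<Rightarrow> (nat \<Rightarrow> nat) \<Rightarrow> nat \<Rightarrow> nat set" where
  "T_fin u v k =
     {\<Sum>h<k. j h * initial_prod u (h + 1) * initial_prod v h | j. \<forall>h<k. j h < v (h + 1)}"

definition S_inf :: "(nat \<Rightarrow> nat) \<Rightarrow> (nat \<Rightarrow> nat) \<Rightarrow> nat set" where
  "S_inf u v = (\<Union>k\<in>{1..}. S_fin u v k)"

definition T_inf :: "(nat \<Rightarrow> nat) \<Rightarrow> (nat \<Rightarrow> nat) \<Rightarrow> nat set" where
  "T_inf u v = (\<Union>k\<in>{1..}. T_fin u v k)"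

definition Lambda_set :: "nat \<Rightarrow> (nat \<Rightarrow> nat) \<Rightarrow> (nat \<Rightarrow> nat) \<Rightarrow> nat set" where
  "Lambda_set l u v = {l ^ s | s. s \<in> S_inf u v}"

text \<open>
  \<open>T_inf u v\<close> is infinite in the case of interest, so the sum is taken over the (finite)
  support of the digits.
\<close>

definition A_set :: "nat \<Rightarrow> (nat \<Rightarrow> nat) \<Rightarrow> (nat \<Rightarrow> nat) \<Rightarrow> nat set" where
  "A_set l u v =
     {\<Sum>t\<in>{t \<in> T_inf u v. \<delta> t \<noteq> 0}. \<delta> t * l ^ t | \<delta>.
        (\<forall>t\<in>T_inf u v. \<delta> t < l) \<and> finite {t \<in> T_inf u v. \<delta> t \<noteq> 0}}"

text \<open>
  An infinite set \<open>X\<close> of natural numbers is listed increasingly by \<open>enumerate X\<close>, from index 0,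
  so its \<open>j\<close>-th element is \<open>enumerate X (j - 1)\<close>; accordingly an index vector of positive
  integers \<open>(i\<^sub>1, i\<^sub>2, \<dots>)\<close> is the function \<open>i\<close> with \<open>i (j - 1) = i\<^sub>j - 1\<close>.
  The topology on \<open>nat\<close> is discrete, so \<open>sums\<close> forces all but finitely many terms to vanish.
\<close>

definition unique_representation :: "nat set \<Rightarrow> nat set \<Rightarrow> bool" where
  "unique_representation L A \<longleftrightarrow>
     (\<forall>n::nat. \<exists>!i::nat \<Rightarrow> nat. (\<lambda>j. enumerate L j * enumerate A (i j)) sums n)"

end

theory Submission
  imports Defs
begin

text \<open>
  Uniqueness of the representations says that the dilates \<open>\<lambda>\<^sub>j A\<close> form an additive system: every
  \<open>n\<close> is uniquely a finite sum of one element from each. By de Bruijn's theorem such a system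
  consists of a mixed radix numeration in which every place is owned by one member, consecutive
  places by different ones, and a member is the set of numbers whose nonzero digits sit at its own
  places. With the owners alternating, the place values owned by a member are exactly its elements
  that are not sums of two nonzero elements of it, so multiplication by \<open>\<lambda>\<^sub>j\<close> carries the places of
  \<open>A\<close> to the places of \<open>\<lambda>\<^sub>j A\<close>, with the same radices. This forces all radices to equal one
  \<open>\<lambda>\<close>, so that \<open>\<Lambda>\<close> consists of powers \<open>\<lambda>\<^sup>s\<close> with \<open>s \<in> S\<close>, \<open>A\<close> of the numbers with digits at
  places \<open>t \<in> T\<close>, and every natural number is uniquely \<open>s + t\<close>. De Bruijn's theorem applied
  once more, now to the two-member system \<open>S, T\<close>, yields the sequences \<open>u\<close> and \<open>v\<close>.
\<close>

subsection \<open>Mixed radix digits\<close>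

definition place :: "(nat \<Rightarrow> nat) \<Rightarrow> nat \<Rightarrow> nat" where
  "place g h = (\<Prod>k<h. g k)"

definition digit :: "(nat \<Rightarrow> nat) \<Rightarrow> nat \<Rightarrow> nat \<Rightarrow> nat" where
  "digit g h x = x div place g h mod g h"

text \<open>\<open>p h\<close> is the owner of place \<open>h\<close>: member \<open>i\<close> may
  use only the places it owns.\<close>

definition digit_family :: "(nat \<Rightarrow> nat) \<Rightarrow> (nat \<Rightarrow> 'i) \<Rightarrow> 'i \<Rightarrow> nat set" where
  "digit_family g p i = {x. \<forall>h. p h \<noteq> i \<longrightarrow> digit g h x = 0}"

lemma place_0 [simp]: "place g 0 = 1"
  by (simp add: place_def)

lemma place_Suc: "place g (Suc h) = place g h * g h"
  by (simp add: place_def)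

lemma place_const [simp]: "place (\<lambda>_. l) h = l ^ h"
  by (simp add: place_def)

lemma digit_0 [simp]: "digit g h 0 = 0"
  by (simp add: digit_def)

lemma digit_expansion:
  "x = (\<Sum>h<n. digit g h x * place g h) + place g n * (x div place g n)"
proof (induction n)
  case (Suc n)
  have "x div place g n = g n * (x div place g n div g n) + digit g n x"
    by (simp add: digit_def)
  then have "place g n * (x div place g n)
      = place g (Suc n) * (x div place g (Suc n)) + digit g n x * place g n"
    by (metis add_mult_distrib2 div_mult2_eq mult.assoc mult.commute place_Suc)
  with Suc show ?case by simp
qed simp

locale radix =
  fixes g :: "nat \<Rightarrow> nat"
  assumes base_ge2: "2 \<le> g h"
begin

lemma base_pos [simp]: "0 < g h"
  using base_ge2[of h] by linarith

lemma place_pos [simp]: "0 < place g h"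
  by (simp add: place_def prod_pos)

lemma place_nonzero [simp]: "place g h \<noteq> 0"
  using place_pos[of h] by linarith

lemma less_place: "n < place g n"
proof (induction n)
  case (Suc n)
  have "place g n * 2 \<le> place g (Suc n)"
    unfolding place_Suc by (rule mult_le_mono2) (rule base_ge2)
  with Suc show ?case by linarith
qed simp

lemma place_dvd: "h \<le> k \<Longrightarrow> place g h dvd place g k"
  by (induction k) (auto simp: place_Suc le_Suc_eq)

lemma place_mono: "h \<le> k \<Longrightarrow> place g h \<le> place g k"
  by (rule dvd_imp_le[OF place_dvd]) auto

lemma place_Suc_ge: "2 * place g h \<le> place g (Suc h)"
  using mult_le_mono2[OF base_ge2[of h], of "place g h"] by (simp add: place_Suc mult.commute)

lemma place_strict: "h < k \<Longrightarrow> place g h < place g k"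
  using place_mono[of "Suc h" k] place_Suc_ge[of h] place_pos[of h] by linarith

lemma place_less_iff [simp]: "place g h < place g k \<longleftrightarrow> h < k"
  using place_strict place_mono by (meson linorder_not_le)

lemma place_eq_iff [simp]: "place g h = place g k \<longleftrightarrow> h = k"
  by (metis place_strict less_irrefl linorder_neqE_nat)

lemma digit_less: "digit g h x < g h"
  by (simp add: digit_def)

lemma digit_eq_0: "x < place g k \<Longrightarrow> k \<le> h \<Longrightarrow> digit g h x = 0"
  using place_mono[of k h] by (simp add: digit_def)

lemma digit_add_multiple:
  assumes "k < n" shows "digit g k (s + d * place g n) = digit g k s"
proof -
  obtain c where c: "place g n = place g k * g k * c"
    using place_dvd[of "Suc k" n] assms by (auto simp: place_Suc elim: dvdE)
  have "(s + d * place g n) div place g k = s div place g k + g k * (c * d)"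
    using div_mult_self2[of "place g k" s "g k * (c * d)"]
    by (simp add: c algebra_simps)
  then show ?thesis by (simp add: digit_def)
qed

lemma sum_digits_less:
  "(\<And>h. h < n \<Longrightarrow> d h < g h) \<Longrightarrow> (\<Sum>h<n. d h * place g h) < place g n"
proof (induction n)
  case (Suc n)
  have "Suc (d n) * place g n \<le> g n * place g n"
    by (rule mult_le_mono1) (simp add: Suc_leI Suc.prems)
  with Suc show ?case by (simp add: place_Suc mult.commute)
qed simp

lemma digit_sum:
  "(\<And>h. h < n \<Longrightarrow> d h < g h) \<Longrightarrow>
   digit g k (\<Sum>h<n. d h * place g h) = (if k < n then d k else 0)"
proof (induction n)
  case (Suc n)
  let ?s = "\<Sum>h<n. d h * place g h"
  have less: "?s < place g n" using Suc.prems by (intro sum_digits_less) auto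
  consider "k < n" | "k = n" | "n < k" by linarith
  then show ?case
  proof cases
    case 1
    with Suc show ?thesis by (simp add: digit_add_multiple)
  next
    case 2
    with less Suc.prems[of n] show ?thesis by (simp add: digit_def)
  next
    case 3
    moreover have "(\<Sum>h<Suc n. d h * place g h) < place g (Suc n)"
      by (rule sum_digits_less) (rule Suc.prems)
    ultimately show ?thesis using digit_eq_0 by simp
  qed
qed simp

lemma expansion: "x < place g n \<Longrightarrow> (\<Sum>h<n. digit g h x * place g h) = x"
  using digit_expansion[of x g n] by simp

lemma digit_eqI:
  assumes "\<And>h. digit g h x = digit g h y" shows "x = y"
proof -
  \<comment> \<open>Place values exceed their index, so the first \<open>x + y\<close> places hold
    both numbers.\<close>
  have "x < place g (x + y)" "y < place g (x + y)"
    using less_place[of "x + y"] by linarith+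
  then have "x = (\<Sum>h<x + y. digit g h x * place g h)" "y = (\<Sum>h<x + y. digit g h y * place g h)"
    by (simp_all only: expansion)
  then show ?thesis unfolding assms by (rule trans[OF _ sym])
qed

lemma digit_eq_0_conv: "(\<forall>h\<ge>k. digit g h x = 0) \<longleftrightarrow> x < place g k"
proof
  assume *: "\<forall>h\<ge>k. digit g h x = 0"
  let ?y = "\<Sum>h<k. digit g h x * place g h"
  have "?y < place g k" by (intro sum_digits_less digit_less)
  moreover have "?y = x"
    by (rule digit_eqI) (use * in \<open>simp add: digit_sum digit_less\<close>)
  ultimately show "x < place g k" by simp
next
  assume "x < place g k"
  then show "\<forall>h\<ge>k. digit g h x = 0" using digit_eq_0 by simp
qed

lemma digit_smult_place:
  assumes "d < g k" shows "digit g h (d * place g k) = (if h = k then d else 0)"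
proof -
  have "(\<Sum>i<Suc k. (if i = k then d else 0) * place g i) = d * place g k"
    by (subst sum.lessThan_Suc) simp
  moreover have "digit g h (\<Sum>i<Suc k. (if i = k then d else 0) * place g i)
      = (if h < Suc k then if h = k then d else 0 else 0)"
    by (rule digit_sum) (use assms in auto)
  ultimately have "digit g h (d * place g k) = (if h < Suc k then if h = k then d else 0 else 0)"
    by (simp only:)
  then show ?thesis by auto
qed

lemma digit_place: "digit g h (place g k) = (if h = k then 1 else 0)"
  using digit_smult_place[of 1 k h] base_ge2[of k] by simp

lemma sum_in_digit_family:
  "(\<And>h. h < n \<Longrightarrow> d h < g h) \<Longrightarrow> (\<And>h. p h \<noteq> i \<Longrightarrow> d h = 0) \<Longrightarrow>
   (\<Sum>h<n. d h * place g h) \<in> digit_family g p i"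
  by (simp add: digit_family_def digit_sum)

end

subsection \<open>Additive systems\<close>

text \<open>The index type may be infinite, so components are summed over their support; its
  finiteness is required separately because \<open>sum\<close> over an infinite set is 0.\<close>

definition represents :: "('i \<Rightarrow> nat set) \<Rightarrow> nat \<Rightarrow> ('i \<Rightarrow> nat) \<Rightarrow> bool" where
  "represents F n x \<longleftrightarrow>
     (\<forall>i. x i \<in> F i) \<and> finite {i. x i \<noteq> 0} \<and> (\<Sum>i | x i \<noteq> 0. x i) = n"

definition additive_system :: "('i \<Rightarrow> nat set) \<Rightarrow> bool" where
  "additive_system F \<longleftrightarrow> (\<forall>n. \<exists>!x. represents F n x)"

lemma represents_sum:
  "represents F n x \<Longrightarrow> finite I \<Longrightarrow> {i. x i \<noteq> 0} \<subseteq> I \<Longrightarrow> sum x I = n"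
  unfolding represents_def by (metis (mono_tags, lifting) DiffE mem_Collect_eq sum.mono_neutral_left)

lemma representsI:
  assumes "finite I" "\<And>i. i \<notin> I \<Longrightarrow> x i = 0" "\<And>i. x i \<in> F i" "sum x I = n"
  shows "represents F n x"
proof -
  have sub: "{i. x i \<noteq> 0} \<subseteq> I" using assms(2) by (auto intro: ccontr)
  have "(\<Sum>i | x i \<noteq> 0. x i) = sum x I"
    by (rule sum.mono_neutral_left[OF assms(1) sub]) simp
  with assms finite_subset[OF sub assms(1)] show ?thesis by (simp add: represents_def)
qed

text \<open>Each place has one owner, so adding up the members produces no carries.\<close>

lemma (in radix) digit_represents:
  assumes "represents (digit_family g p) n x"
  shows "digit g h n = digit g h (x (p h))"
proof -
  \<comment> \<open>Every component fits into the first \<open>N\<close> places, and place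
    \<open>h\<close> is among them. The set \<open>I\<close> joins the owners of these places to the
    support, so that each inner sum below picks out an owner.\<close>
  define N where "N = n + h + 1"
  define I where "I = insert (p h) ({i. x i \<noteq> 0} \<union> p ` {..<N})"
  have fin: "finite I" using assms by (auto simp: I_def represents_def)
  have xF: "x i \<in> digit_family g p i" for i using assms by (simp add: represents_def)
  have n: "sum x I = n"
    using represents_sum[OF assms fin] by (auto simp: I_def)
  have le: "x i < place g N" for i
  proof (cases "i \<in> I")
    case True
    then have "x i \<le> n" using n member_le_sum[OF True, of x] fin by simp
    then show ?thesis using less_place[of N] by (simp add: N_def)
  next
    case False
    then show ?thesis by (simp add: I_def)
  qed
  have "n = (\<Sum>i\<in>I. \<Sum>k<N. digit g k (x i) * place g k)"
    unfolding n[symmetric] by (intro sum.cong refl expansion[symmetric] le)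
  also have "\<dots> = (\<Sum>k<N. \<Sum>i\<in>I. digit g k (x i) * place g k)"
    by (rule sum.swap)
  also have "\<dots> = (\<Sum>k<N. digit g k (x (p k)) * place g k)"
  proof (intro sum.cong refl)
    fix k assume "k \<in> {..<N}"
    then have k: "p k \<in> I" by (simp add: I_def)
    have "(\<Sum>i\<in>I. digit g k (x i) * place g k)
        = (\<Sum>i\<in>I. if i = p k then digit g k (x (p k)) * place g k else 0)"
      using xF by (intro sum.cong) (auto simp: digit_family_def)
    also have "\<dots> = digit g k (x (p k)) * place g k" using fin k by simp
    finally show "(\<Sum>i\<in>I. digit g k (x i) * place g k) = digit g k (x (p k)) * place g k" .
  qed
  finally have "digit g h n = digit g h (\<Sum>k<N. digit g k (x (p k)) * place g k)" by simp
  also have "\<dots> = digit g h (x (p h))"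
    by (subst digit_sum) (auto simp: digit_less N_def)
  finally show ?thesis .
qed

text \<open>Handing each digit of \<open>n\<close> to the owner of its place gives a representation;
  \<open>digit_represents\<close> leaves no other.\<close>

lemma (in radix) additive_system_digit_family: "additive_system (digit_family g p)"
  unfolding additive_system_def
proof (intro allI ex_ex1I)
  fix n
  define x where "x i = (\<Sum>h<n. (if p h = i then digit g h n else 0) * place g h)" for i
  have "represents (digit_family g p) n x"
  proof (rule representsI)
    show "finite (p ` {..<n})" by simp
    show "x i = 0" if "i \<notin> p ` {..<n}" for i
      using that by (auto simp: x_def)
    show "x i \<in> digit_family g p i" for i
      unfolding x_def by (rule sum_in_digit_family) (auto simp: digit_less)
    have "sum x (p ` {..<n})
        = (\<Sum>h<n. \<Sum>i\<in>p ` {..<n}. (if p h = i then digit g h n else 0) * place g h)"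
      unfolding x_def by (rule sum.swap)
    also have "\<dots> = (\<Sum>h<n. digit g h n * place g h)"
      by (intro sum.cong refl) (simp flip: sum_distrib_right)
    also have "\<dots> = n" by (rule expansion) (rule less_place)
    finally show "sum x (p ` {..<n}) = n" .
  qed
  then show "\<exists>x. represents (digit_family g p) n x" by (rule exI[of _ x])
next
  fix n x y
  assume xy: "represents (digit_family g p) n x" "represents (digit_family g p) n y"
  show "x = y"
  proof
    fix i
    have "digit g h (x i) = digit g h (y i)" for h
    proof (cases "p h = i")
      case True
      then show ?thesis using digit_represents[of p n _ h] xy by metis
    next
      case False
      have "x i \<in> digit_family g p i" "y i \<in> digit_family g p i"
        using xy by (auto simp: represents_def)
      with False show ?thesis by (simp add: digit_family_def)
    qed
    then show "x i = y i" by (rule digit_eqI)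
  qed
qed

section \<open>Direct sum decompositions of the natural numbers\<close>

text \<open>Numbers below \<open>g\<close> lie in \<open>A\<close>, since their
  \<open>B\<close>-part can only be 0. From there the structure (\<open>A\<close> a union of blocks
  of length \<open>g\<close>, \<open>B\<close> made of multiples of \<open>g\<close>) spreads by
  strong induction on the block number.\<close>

lemma tiling_blocks:
  fixes A B :: "nat set"
  assumes ex: "\<And>n. \<exists>a\<in>A. \<exists>b\<in>B. n = a + b"
    and uniq: "\<And>a b a' b'. \<lbrakk>a \<in> A; b \<in> B; a' \<in> A; b' \<in> B; a + b = a' + b'\<rbrakk> \<Longrightarrow> a = a' \<and> b = b'"
    and zero: "0 \<in> A" "0 \<in> B"
    and g: "g \<in> B" "g \<noteq> 0" and least: "\<And>b. b \<in> B \<Longrightarrow> b \<noteq> 0 \<Longrightarrow> g \<le> b"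
    and r: "r < g"
  shows "(g * n + r \<in> A \<longleftrightarrow> g * n \<in> A) \<and> (g * n + r \<in> B \<longrightarrow> r = 0)"
  using r
proof (induction n arbitrary: r rule: less_induct)
  case (less n)
  have small: "s \<in> A" if "s < g" for s
  proof -
    obtain a b where ab: "a \<in> A" "b \<in> B" "s = a + b" using ex by blast
    then have "b = 0" using least[of b] that by linarith
    with ab show ?thesis by simp
  qed
  have AB: "x = 0" if "x \<in> A" "x \<in> B" for x
    using uniq[of x 0 0 x] zero that by simp
  show ?case
  proof (cases "n = 0")
    case True
    then show ?thesis using small[of r] zero AB[of r] less.prems by auto
  next
    case False
    then have gn: "0 < g * n" using g by simp
    have IH_B: "\<exists>m<n. b = g * m" if "b \<in> B" "b < g * n" for b
    proof -
      have m: "b div g < n" using that g by (simp add: less_mult_imp_div_less mult.commute)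
      have "b mod g = 0"
        using less.IH[OF m, of "b mod g"] that g by simp
      with m show ?thesis by (metis add.right_neutral mult_div_mod_eq)
    qed
    obtain a b where ab: "a \<in> A" "b \<in> B" "g * n = a + b" using ex by blast
    \<comment> \<open>If \<open>b = 0\<close>, the whole block lies in \<open>A\<close>; if
      \<open>b = g * n\<close>, it misses \<open>A\<close> and meets \<open>B\<close> only in its
      first element; otherwise it is an earlier block of \<open>A\<close> translated by
      \<open>b\<close> and meets neither set.\<close>
    consider "b = 0" | "b = g * n" "a = 0" | "0 < b" "b < g * n" using ab by linarith
    then show ?thesis
    proof cases
      case 1
      then have aA: "g * n \<in> A" using ab by simp
      obtain a' b' where ab': "a' \<in> A" "b' \<in> B" "g * n + r = a' + b'" using ex by blast
      have "b' = 0"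
      proof (rule ccontr)
        assume "b' \<noteq> 0"
        show False
        proof (cases "b' < g * n")
          case True
          then obtain m where m: "m < n" "b' = g * m" using IH_B ab' by blast
          have a': "a' = g * (n - m) + r"
            using ab'(3) m by (simp add: diff_mult_distrib2 algebra_simps)
          have "n - m < n" using \<open>b' \<noteq> 0\<close> m by (cases m) auto
          then have "g * (n - m) \<in> A"
            using less.IH[of "n - m" r] less.prems ab'(1) a' by simp
          moreover have "g * (n - m) + b' = g * n + 0"
            using m by (simp add: diff_mult_distrib2)
          ultimately show False using uniq[OF _ ab'(2) aA zero(2)] \<open>b' \<noteq> 0\<close> by blast
        next
          case False
          define s where "s = b' - g * n"
          have s: "b' = g * n + s" "s \<le> r" using False ab'(3) by (auto simp: s_def)
          show False
          \<comment> \<open>If \<open>s > 0\<close>, then \<open>g n + g\<close> has the two decompositions \<open>g n + g\<close> and \<open>(g - s) + b'\<close>.\<close>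
          proof (cases "s = 0")
            case True
            then show False using AB[OF aA] s ab'(2) gn by simp
          next
            case False
            have "g - s \<in> A" using small False g by simp
            moreover have "(g - s) + b' = g * n + g" using s less.prems by simp
            ultimately have "g - s = g * n" using uniq[OF _ ab'(2) aA g(1)] by blast
            moreover have "g \<le> g * n" using gn by (cases n) auto
            ultimately show False using False g by linarith
          qed
        qed
      qed
      then have A: "g * n + r \<in> A" using ab' by simp
      moreover have "g * n + r \<notin> B" using AB[OF A] gn by auto
      ultimately show ?thesis using aA by blast
    next
      case 2
      have gnB: "g * n \<in> B" using 2(1) ab(2) by simp
      then have "g * n \<notin> A" using AB[of "g * n"] gn by linarith
      moreover have "g * n + r \<notin> A"
      proof
        assume "g * n + r \<in> A"
        then have "0 = g * n"
          using uniq[of "g * n + r" 0 r "g * n"] zero(2) small[OF less.prems] gnB by simp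
        then show False using gn by simp
      qed
      moreover have "r = 0" if "g * n + r \<in> B"
        using uniq[OF zero(1) that small[OF less.prems] gnB] by simp
      ultimately show ?thesis by blast
    next
      case 3
      then obtain m where m: "m < n" "b = g * m" using IH_B ab by blast
      have a: "a = g * (n - m)" using ab(3) m by (simp add: diff_mult_distrib2)
      have "n - m < n" using 3 m by (cases m) auto
      then have ar: "a + r \<in> A" using less.IH[of "n - m" r] less.prems ab(1) a by simp
      have gnA: "g * n \<notin> A" using uniq[OF _ zero(2) ab(1,2)] ab(3) 3 by auto
      have "g * n + r \<notin> A"
      proof
        assume "g * n + r \<in> A"
        then have "0 = b" using uniq[OF _ zero(2) ar ab(2), of "g * n + r"] ab(3) by simp
        then show False using 3 by simp
      qed
      moreover have "g * n + r \<notin> B"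
      proof
        assume "g * n + r \<in> B"
        then have "g * n + r = b" using uniq[OF zero(1) _ ar ab(2), of "g * n + r"] ab(3) by simp
        then show False using 3 by simp
      qed
      ultimately show ?thesis using gnA by blast
    qed
  qed
qed

section \<open>De Bruijn's structure theorem\<close>

lemma represents_singleton:
  assumes "\<And>i. 0 \<in> F i" "a \<in> F i"
  shows "represents F a (\<lambda>k. if k = i then a else 0)"
  by (rule representsI[of "{i}"]) (use assms in auto)

lemma represents_update:
  assumes "represents F b x" "x z = 0" "a \<in> F z"
  shows "represents F (a + b) (x(z := a))"
proof -
  let ?I = "{i. x i \<noteq> 0}"
  have I: "finite ?I" "z \<notin> ?I" using assms by (auto simp: represents_def)
  show ?thesis
  proof (rule representsI[of "insert z ?I"])
    have "sum (x(z := a)) ?I = sum x ?I" by (rule sum.cong) (use I in auto)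
    also have "\<dots> = b" using assms(1) by (simp add: represents_def)
    finally show "sum (x(z := a)) (insert z ?I) = a + b" using I by simp
  qed (use I assms in \<open>auto simp: represents_def\<close>)
qed

lemma represents_remove:
  assumes "represents F n x" "0 \<in> F z"
  shows "\<exists>b. n = x z + b \<and> represents F b (x(z := 0))"
proof -
  let ?I = "insert z {i. x i \<noteq> 0}"
  have I: "finite ?I" using assms by (auto simp: represents_def)
  have "n = x z + sum x (?I - {z})"
    using represents_sum[OF assms(1) I] I by (metis insertI1 subset_insertI sum.remove)
  moreover have "represents F (sum x (?I - {z})) (x(z := 0))"
  proof (rule representsI[of "?I - {z}"])
    show "sum (x(z := 0)) (?I - {z}) = sum x (?I - {z})" by (rule sum.cong) auto
  qed (use I assms in \<open>auto simp: represents_def\<close>)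
  ultimately show ?thesis by blast
qed

text \<open>Carries existence and uniqueness of representations over to quotients by
  \<open>g\<close>; for existence the components must first be shown divisible by
  \<open>g\<close>.\<close>

lemma represents_scale:
  assumes "0 < g"
  shows "represents (\<lambda>i. {y. g * y \<in> F i}) n y \<longleftrightarrow> represents F (g * n) (\<lambda>i. g * y i)"
  using assms by (auto simp: represents_def simp flip: sum_distrib_left)

lemma additive_systemD:
  assumes "additive_system F"
  shows "\<exists>x. represents F n x" "represents F n x \<Longrightarrow> represents F n y \<Longrightarrow> x = y"
  using assms unfolding additive_system_def by blast+

lemma additive_system_zero:
  assumes "additive_system F" shows "0 \<in> F i"
proof -
  obtain x where x: "represents F 0 x" using additive_systemD(1)[OF assms] by blast
  then have "x i = 0" by (auto simp: represents_def)
  moreover have "x i \<in> F i" using x by (simp add: represents_def)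
  ultimately show ?thesis by simp
qed

lemma additive_system_one:
  assumes "additive_system F" shows "\<exists>i. 1 \<in> F i"
proof -
  obtain x where x: "represents F 1 x" using additive_systemD(1)[OF assms] by blast
  have "(\<Sum>i | x i \<noteq> 0. x i) = Suc 0" using x by (simp add: represents_def)
  then obtain i where "x i = Suc 0"
    using x by (auto simp: represents_def sum_eq_Suc0_iff)
  with x show ?thesis by (metis One_nat_def represents_def)
qed

lemma additive_system_disjoint:
  assumes F: "additive_system F" and "x \<in> F i" "x \<in> F j" "i \<noteq> j"
  shows "x = 0"
proof -
  note 0 = additive_system_zero[OF F]
  have "(\<lambda>k. if k = i then x else 0) = (\<lambda>k. if k = j then x else 0)"
    using represents_singleton[of F, OF 0 \<open>x \<in> F i\<close>] represents_singleton[of F, OF 0 \<open>x \<in> F j\<close>]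
    by (rule additive_systemD(2)[OF F])
  from fun_cong[OF this, of i] \<open>i \<noteq> j\<close> show ?thesis by simp
qed

text \<open>Peels off the lowest place: \<open>z\<close> is its owner, \<open>g\<close> its radix
  and \<open>F'\<close> the system of quotients by \<open>g\<close>. Lumping all members except
  \<open>z\<close> into one set \<open>B\<close> reduces this to a tiling by two sets. That
  \<open>1 \<notin> F' z\<close> will force the next place to have another owner.\<close>

lemma additive_system_step:
  fixes F :: "'i \<Rightarrow> nat set"
  assumes F: "additive_system F" and inf: "\<And>i. infinite (F i)"
    and z: "1 \<in> F z" and j: "j \<noteq> z"
  shows "\<exists>F' g. additive_system F' \<and> (\<forall>i. infinite (F' i)) \<and> 2 \<le> g \<and> 1 \<notin> F' z \<and>
    (\<forall>i x. x \<in> F i \<longleftrightarrow> x div g \<in> F' i \<and> (i \<noteq> z \<longrightarrow> x mod g = 0))"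
proof -
  note zero = additive_system_zero[OF F]
  note unique = additive_systemD(2)[OF F]
  define B where "B = {b. \<exists>x. represents F b x \<and> x z = 0}"
  have ex: "\<exists>a\<in>F z. \<exists>b\<in>B. n = a + b" for n
  proof -
    obtain x where x: "represents F n x" using additive_systemD(1)[OF F] by blast
    then have "x z \<in> F z" by (simp add: represents_def)
    with represents_remove[OF x zero] show ?thesis unfolding B_def by fastforce
  qed
  have uniq: "a = a' \<and> b = b'"
    if "a \<in> F z" "b \<in> B" "a' \<in> F z" "b' \<in> B" "a + b = a' + b'" for a b a' b'
  proof -
    note bb = that(2,4)
    obtain x y where xy: "represents F b x" "x z = 0" "represents F b' y" "y z = 0"
      using bb unfolding B_def by blast
    have "x(z := a) = y(z := a')"
      using represents_update[OF xy(1,2) that(1)] represents_update[OF xy(3,4) that(3)]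
      unfolding that(5) by (rule unique)
    from fun_cong[OF this, of z] that(5) show ?thesis by simp
  qed
  have FB: "x \<in> B" if "x \<in> F i" "i \<noteq> z" for x i
    using represents_singleton[of F, OF zero that(1)] that(2) unfolding B_def by force
  have zB: "0 \<in> B" using FB[OF zero j] .
  \<comment> \<open>The member \<open>F j\<close> supplies a nonzero element of \<open>B\<close>, so
    a least one exists.\<close>
  define g where "g = (LEAST b. b \<in> B \<and> b \<noteq> 0)"
  have "\<exists>c\<in>F j. c \<noteq> 0"
    using inf[of j] by (metis finite.emptyI finite_insert finite_subset insertCI subsetI)
  then have exg: "\<exists>b. b \<in> B \<and> b \<noteq> 0" using FB j by blast
  have g: "g \<in> B" "g \<noteq> 0"
    using LeastI_ex[OF exg] unfolding g_def by auto
  have least: "g \<le> b" if "b \<in> B" "b \<noteq> 0" for b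
    unfolding g_def by (rule Least_le) (use that in simp)
  have blocks: "(g * n + r \<in> F z \<longleftrightarrow> g * n \<in> F z) \<and> (g * n + r \<in> B \<longrightarrow> r = 0)"
    if "r < g" for r n
    by (rule tiling_blocks) (fact ex uniq zero zB g least that)+
  have blocks': "(x \<in> F z \<longleftrightarrow> g * (x div g) \<in> F z) \<and> (x \<in> B \<longrightarrow> x mod g = 0)" for x
    using blocks[of "x mod g" "x div g", OF mod_less_divisor] g(2) by simp
  \<comment> \<open>\<open>g\<close> already lies in \<open>B\<close>; its absence from
    \<open>F z\<close> gives both \<open>g \<noteq> 1\<close> and
    \<open>1 \<notin> F' z\<close>.\<close>
  have gA: "g \<notin> F z" using uniq[of g 0 0 g] zero zB g by auto
  have B_dvd: "g dvd b" if "b \<in> B" for b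
    using blocks'[of b] that by (simp only: dvd_eq_mod_eq_0)
  define F' where "F' i = {y. g * y \<in> F i}" for i
  have memb: "x \<in> F i \<longleftrightarrow> x div g \<in> F' i \<and> (i \<noteq> z \<longrightarrow> x mod g = 0)" for i x
  proof (cases "i = z")
    case True
    then show ?thesis
      using blocks'[of x] by (simp add: F'_def)
  next
    case False
    have "g dvd x" if "x \<in> F i" using B_dvd FB[OF that False] .
    then show ?thesis using False by (auto simp: F'_def elim: dvdE)
  qed
  have "g \<noteq> 1" using gA z by auto
  then have "2 \<le> g" using g by linarith
  moreover have "1 \<notin> F' z" using gA by (simp add: F'_def)
  moreover have "infinite (F' i)" for i
  proof
    assume "finite (F' i)"
    then have "finite ((\<lambda>(y, r). g * y + r) ` (F' i \<times> {..<g}))" by simp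
    moreover have "F i \<subseteq> (\<lambda>(y, r). g * y + r) ` (F' i \<times> {..<g})"
    proof
      fix x assume "x \<in> F i"
      then have "x = (\<lambda>(y, r). g * y + r) (x div g, x mod g)"
        "(x div g, x mod g) \<in> F' i \<times> {..<g}"
        using memb[of x i] g by auto
      then show "x \<in> (\<lambda>(y, r). g * y + r) ` (F' i \<times> {..<g})" by (rule image_eqI)
    qed
    ultimately show False using inf finite_subset by blast
  qed
  moreover have "additive_system F'"
    unfolding additive_system_def
  proof (intro allI ex_ex1I)
    fix n
    obtain x where x: "represents F (g * n) x" using additive_systemD(1)[OF F] by blast
    have xF: "x i \<in> F i" for i using x by (simp add: represents_def)
    obtain b where b: "g * n = x z + b" "represents F b (x(z := 0))"
      using represents_remove[OF x zero] by blast
    \<comment> \<open>The sum \<open>b\<close> of the other components is a multiple of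
      \<open>g\<close>, hence so is \<open>x z = g * n - b\<close>; every other component lies in
      \<open>B\<close> by itself.\<close>
    then have "b \<in> B" unfolding B_def by force
    then have "g dvd x z" using B_dvd b(1) by (metis dvd_add_left_iff dvd_triv_left)
    then have "g dvd x i" for i
      using B_dvd FB[OF xF] by (cases "i = z") auto
    then have "(\<lambda>i. g * (x i div g)) = x" by auto
    then have "represents F' n (\<lambda>i. x i div g)"
      using x represents_scale[of g F n "\<lambda>i. x i div g"] g unfolding F'_def by simp
    then show "\<exists>x. represents F' n x" by (rule exI[of _ "\<lambda>i. x i div g"])
  next
    fix n x y
    assume "represents F' n x" "represents F' n y"
    then have "(\<lambda>i. g * x i) = (\<lambda>i. g * y i)"
      using represents_scale[of g F n] g unique unfolding F'_def by blast
    then have "g * x i = g * y i" for i by (rule fun_cong)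
    then show "x = y" using g by auto
  qed
  ultimately have "additive_system F' \<and> (\<forall>i. infinite (F' i)) \<and> 2 \<le> g \<and> 1 \<notin> F' z \<and>
    (\<forall>i x. x \<in> F i \<longleftrightarrow> x div g \<in> F' i \<and> (i \<noteq> z \<longrightarrow> x mod g = 0))"
    by (intro conjI allI memb)
  then show ?thesis by (intro exI)
qed

text \<open>Iterating the step gives a radix \<open>g n\<close> and an owner \<open>p n\<close> at
  each stage. After \<open>n\<close> stages, membership in \<open>F i\<close> is a condition on the
  first \<open>n\<close> digits together with membership of the quotient in the remaining system; at
  stage \<open>x\<close> the quotient of \<open>x\<close> is 0 and only the digits matter.\<close>

theorem additive_system_structure:
  fixes F :: "'i \<Rightarrow> nat set"
  assumes F: "additive_system F" and inf: "\<And>i. infinite (F i)" and ij: "(i::'i) \<noteq> j"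
  obtains g p where "radix g" "\<And>h. p (Suc h) \<noteq> p h" "F = digit_family g p"
proof -
  define P where "P F \<longleftrightarrow> additive_system F \<and> (\<forall>i. infinite (F i))" for F :: "'i \<Rightarrow> nat set"
  define Q where "Q F F' g z \<longleftrightarrow> P F' \<and> 2 \<le> g \<and> 1 \<in> F z \<and> 1 \<notin> F' z \<and>
    (\<forall>i x. x \<in> F i \<longleftrightarrow> x div g \<in> F' i \<and> (i \<noteq> z \<longrightarrow> x mod g = 0))"
    for F F' :: "'i \<Rightarrow> nat set" and g z
  have "\<exists>F' g z. Q F F' g z" if P: "P F" for F
  proof -
    obtain z where z: "1 \<in> F z" using P additive_system_one unfolding P_def by blast
    obtain k where k: "k \<noteq> z" using ij by metis
    obtain F' g where "additive_system F' \<and> (\<forall>i. infinite (F' i)) \<and> 2 \<le> g \<and> 1 \<notin> F' z \<and>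
      (\<forall>i x. x \<in> F i \<longleftrightarrow> x div g \<in> F' i \<and> (i \<noteq> z \<longrightarrow> x mod g = 0))"
      using additive_system_step[of F, OF _ _ z k] P unfolding P_def by blast
    with z have "Q F F' g z" unfolding Q_def P_def by simp
    then show ?thesis by (intro exI)
  qed
  \<comment> \<open>Choice makes the next system, the radix and the owner functions of the current
    system, so that the stages are iterates of \<open>f\<close>.\<close>
  then obtain f b w where Q: "\<And>F. P F \<Longrightarrow> Q F (f F) (b F) (w F)" by metis
  define Fs where "Fs n = (f ^^ n) F" for n
  define g where "g n = b (Fs n)" for n
  define p where "p n = w (Fs n)" for n
  have Fs_0: "Fs 0 = F" and Fs_Suc: "Fs (Suc n) = f (Fs n)" for n by (simp_all add: Fs_def)
  have P: "P (Fs n)" for n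
  proof (induction n)
    case 0
    then show ?case using F inf by (simp add: Fs_0 P_def)
  next
    case (Suc n)
    then show ?case using Q[of "Fs n"] by (simp add: Fs_Suc Q_def)
  qed
  have Qn: "Q (Fs n) (Fs (Suc n)) (g n) (p n)" for n
    using Q[OF P[of n]] by (simp add: Fs_Suc g_def p_def)
  have "radix g" by standard (use Qn in \<open>simp add: Q_def\<close>)
  \<comment> \<open>In the system \<open>Fs (Suc n)\<close>, 1 belongs to the member
    \<open>p (Suc n)\<close> but not to the member \<open>p n\<close>.\<close>
  have "p (Suc n) \<noteq> p n" for n
    using Qn[of n] Qn[of "Suc n"] unfolding Q_def by metis
  have memb: "x \<in> F i \<longleftrightarrow> x div place g n \<in> Fs n i \<and> (\<forall>h<n. p h \<noteq> i \<longrightarrow> digit g h x = 0)" for x i n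
  proof (induction n)
    case (Suc n)
    have step: "\<forall>y. y \<in> Fs n i \<longleftrightarrow> y div g n \<in> Fs (Suc n) i \<and> (i \<noteq> p n \<longrightarrow> y mod g n = 0)"
      using Qn[of n] by (simp add: Q_def)
    show ?case
      unfolding Suc step[rule_format, of "x div place g n"]
      by (auto simp: place_Suc div_mult2_eq digit_def less_Suc_eq)
  qed (simp add: Fs_0)
  have "F i = digit_family g p i" for i
  proof (intro set_eqI iffI)
    fix x assume "x \<in> F i"
    then have "digit g h x = 0" if "p h \<noteq> i" for h
      using memb[of x i "Suc h"] that by blast
    then show "x \<in> digit_family g p i" by (simp add: digit_family_def)
  next
    fix x assume "x \<in> digit_family g p i"
    moreover have "x div place g x = 0" using radix.less_place[OF \<open>radix g\<close>] by simp
    moreover have "0 \<in> Fs x i" using P[of x] additive_system_zero[of "Fs x" i] unfolding P_def by simp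
    ultimately show "x \<in> F i" unfolding memb[of x i x] by (simp add: digit_family_def)
  qed
  then have "F = digit_family g p" ..
  then show thesis using that \<open>radix g\<close> \<open>\<And>n. p (Suc n) \<noteq> p n\<close> by blast
qed

subsection \<open>Additive systems of dilates\<close>

text \<open>Refers only to addition inside \<open>X\<close>, so it is compatible with dilation and
  recovers the owned place values from the bare set.\<close>

definition irreducibles :: "nat set \<Rightarrow> nat set" where
  "irreducibles X = {x \<in> X. x \<noteq> 0 \<and> (\<forall>y\<in>X. \<forall>w\<in>X. x = y + w \<longrightarrow> y = 0 \<or> w = 0)}"

lemma irreducibles_sumD:
  "x \<in> irreducibles X \<Longrightarrow> y \<in> X \<Longrightarrow> w \<in> X \<Longrightarrow> x = y + w \<Longrightarrow> y = 0 \<or> w = 0"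
  by (simp add: irreducibles_def)

lemma irreducibles_scale:
  assumes "0 < c" shows "c * x \<in> irreducibles ((*) c ` X) \<longleftrightarrow> x \<in> irreducibles X"
  using assms by (auto simp: irreducibles_def simp flip: distrib_left)

locale alternating_radix = radix +
  fixes p :: "nat \<Rightarrow> 'i"
  assumes alternating: "p (Suc h) \<noteq> p h"
begin

text \<open>An element splits off the place of any nonzero digit, so an irreducible one is itself a
  place. Conversely, two nonzero summands of \<open>place g (Suc k)\<close> stay below
  \<open>place g k\<close>, which has another owner, and their sum is too small.\<close>

lemma irreducible_iff_place:
  "x \<in> irreducibles (digit_family g p i) \<longleftrightarrow> (\<exists>h. p h = i \<and> x = place g h)"
proof
  assume x: "x \<in> irreducibles (digit_family g p i)"
  then have xF: "x \<in> digit_family g p i" and "x \<noteq> 0" by (auto simp: irreducibles_def)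
  then obtain h where h: "digit g h x \<noteq> 0" using digit_eqI[of x 0] by auto
  with xF have p: "p h = i" by (auto simp: digit_family_def)
  define n where "n = x + h + 1"
  \<comment> \<open>\<open>y\<close> is \<open>x\<close> with digit \<open>h\<close> lowered by
    1.\<close>
  define y where "y = (\<Sum>k<n. (digit g k x - (if k = h then 1 else 0)) * place g k)"
  have y: "y \<in> digit_family g p i"
    unfolding y_def
    by (rule sum_in_digit_family) (use xF digit_less in \<open>auto simp: digit_family_def less_imp_diff_less\<close>)
  have "x < place g n" using less_place[of n] by (simp add: n_def)
  then have "x = (\<Sum>k<n. digit g k x * place g k)" by (rule expansion[symmetric])
  also have "\<dots> = (\<Sum>k<n. (digit g k x - (if k = h then 1 else 0)) * place g k
      + (if k = h then place g h else 0))"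
  proof (rule sum.cong[OF refl])
    fix k
    show "digit g k x * place g k = (digit g k x - (if k = h then 1 else 0)) * place g k
        + (if k = h then place g h else 0)"
      using h by (cases "digit g h x") auto
  qed
  also have "\<dots> = y + place g h" by (simp add: sum.distrib y_def n_def)
  finally have "x = y + place g h" .
  moreover have "place g h \<in> digit_family g p i" using p by (auto simp: digit_family_def digit_place)
  ultimately have "y = 0 \<or> place g h = 0" using x y by (intro irreducibles_sumD)
  then show "\<exists>h. p h = i \<and> x = place g h" using p \<open>x = y + place g h\<close> place_pos[of h] by auto
next
  assume "\<exists>h. p h = i \<and> x = place g h"
  then obtain h where h: "p h = i" "x = place g h" by blast
  have "y = 0 \<or> w = 0"
    if yw: "y \<in> digit_family g p i" "w \<in> digit_family g p i" "x = y + w" for y w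
  proof (cases h)
    case 0
    then show ?thesis using h yw by auto
  next
    case (Suc k)
    \<comment> \<open>Place \<open>k\<close> has another owner, so a carry into place \<open>Suc k\<close> is impossible.\<close>
    have small: "v < place g k" if v: "v \<in> digit_family g p i" "v < place g h" for v
    proof -
      have "digit g m v = 0" if "k \<le> m" for m
      proof (cases "m = k")
        case True
        then show ?thesis using v alternating[of k] Suc h by (simp add: digit_family_def)
      next
        case False
        then show ?thesis using that v(2) Suc digit_eq_0[of v h m] by simp
      qed
      then show ?thesis using digit_eq_0_conv by blast
    qed
    show ?thesis
    proof (rule ccontr)
      assume "\<not> (y = 0 \<or> w = 0)"
      then have "y < place g h" "w < place g h" using yw h by auto
      then have "y < place g k" "w < place g k" using small yw(1,2) by simp_all
      then show False using yw(3) h(2) place_Suc_ge[of k] unfolding Suc by linarith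
    qed
  qed
  moreover have "x \<in> digit_family g p i" using h by (auto simp: digit_family_def digit_place)
  ultimately show "x \<in> irreducibles (digit_family g p i)" using h by (simp add: irreducibles_def)
qed

text \<open>So \<open>g h\<close> is the least multiplier that leads out of the family: the product
  is then the next place, which has another owner. Thus a set determines the radices at its places,
  and dilation preserves them.\<close>

lemma multiples_in_digit_family:
  assumes "p h = i"
  shows "d < g h \<Longrightarrow> d * place g h \<in> digit_family g p i"
    and "g h * place g h \<notin> digit_family g p i"
proof -
  show "d * place g h \<in> digit_family g p i" if "d < g h"
    using assms that by (auto simp: digit_family_def digit_smult_place)
  have "digit g (Suc h) (g h * place g h) = 1"
    using digit_place[of "Suc h" "Suc h"] by (simp add: place_Suc mult.commute)
  then show "g h * place g h \<notin> digit_family g p i"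
    using assms alternating[of h] by (auto simp: digit_family_def)
qed

lemma dilate_place:
  assumes "digit_family g p j = (*) c ` digit_family g p i" "0 < c"
    and "p h = i" "p k = j" "place g k = c * place g h"
  shows "g k = g h"
proof -
  have "d * place g k \<in> digit_family g p j \<longleftrightarrow> d * place g h \<in> digit_family g p i" for d
    using assms by (auto simp: mult.left_commute)
  then show ?thesis
    using multiples_in_digit_family[OF \<open>p h = i\<close>] multiples_in_digit_family[OF \<open>p k = j\<close>]
    by (metis linorder_neqE_nat)
qed

text \<open>Dilation matches the irreducibles of the two members, hence their places.\<close>

lemma dilate_place_ex:
  assumes eq: "digit_family g p j = (*) c ` digit_family g p i" and c: "0 < c"
  shows "p h = i \<Longrightarrow> \<exists>k. p k = j \<and> place g k = c * place g h \<and> g k = g h"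
    and "p k = j \<Longrightarrow> \<exists>h. p h = i \<and> place g k = c * place g h \<and> g k = g h"
proof -
  assume h: "p h = i"
  then have "c * place g h \<in> irreducibles (digit_family g p j)"
    unfolding eq irreducibles_scale[OF c] using irreducible_iff_place by blast
  then obtain k where k: "p k = j" "c * place g h = place g k" using irreducible_iff_place by blast
  with h dilate_place[OF eq c h k(1)] show "\<exists>k. p k = j \<and> place g k = c * place g h \<and> g k = g h"
    by metis
next
  assume k: "p k = j"
  then have irr: "place g k \<in> irreducibles (digit_family g p j)" using irreducible_iff_place by blast
  then obtain x where x: "place g k = c * x" unfolding irreducibles_def eq by blast
  with irr have "x \<in> irreducibles (digit_family g p i)"
    unfolding eq using irreducibles_scale[OF c] by simp
  then obtain h where h: "p h = i" "x = place g h" using irreducible_iff_place by blast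
  with x k dilate_place[OF eq c h(1) k] show "\<exists>h. p h = i \<and> place g k = c * place g h \<and> g k = g h"
    by metis
qed

end

section \<open>Equality of all radices\<close>

locale dilates = alternating_radix g p for g and p :: "nat \<Rightarrow> 'i" +
  fixes c :: "'i \<Rightarrow> nat" and A :: "nat set"
  assumes family_eq: "digit_family g p i = (*) (c i) ` A"
    and c_pos: "0 < c i" and c_inj: "inj c"
begin

text \<open>The owner of place 0 contains 1, and its elements are multiples of
  \<open>c (p 0)\<close>.\<close>

lemma c_owner_0: "c (p 0) = 1"
proof -
  have "1 \<in> digit_family g p (p 0)"
    using digit_place[of _ 0] by (auto simp: digit_family_def)
  then show ?thesis using family_eq by auto
qed

lemma A_eq: "A = digit_family g p (p 0)"
  using family_eq[of "p 0"] c_owner_0 by simp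

lemma family_dilate: "digit_family g p i = (*) (c i) ` digit_family g p (p 0)"
  unfolding A_eq[symmetric] by (rule family_eq)

lemmas to_owner = dilate_place_ex(1)[OF family_dilate c_pos]
lemmas from_owner = dilate_place_ex(2)[OF family_dilate c_pos]

lemma c_gt_1: "i \<noteq> p 0 \<Longrightarrow> 1 < c i"
  using c_pos[of i] c_owner_0 c_inj unfolding inj_def by (metis less_one linorder_neqE_nat less_irrefl)

lemma c_is_place: "\<exists>k. p k = i \<and> c i = place g k"
  using to_owner[of 0 i] by auto

text \<open>A factor above 1 makes the source place strictly earlier; this is the descent behind
  \<open>base_const\<close>.\<close>

lemma from_owner_less:
  assumes "p k \<noteq> p 0"
  shows "\<exists>h<k. p h = p 0 \<and> place g k = c (p k) * place g h \<and> g k = g h"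
proof -
  obtain h where h: "p h = p 0" "place g k = c (p k) * place g h" "g k = g h"
    using from_owner by blast
  then have "place g h < place g k" using c_gt_1[OF assms] by simp
  then have "h < k" by simp
  with h show ?thesis by blast
qed

lemma c_owner_1: "c (p 1) = g 0"
  using from_owner_less[of 1] alternating[of 0] by (simp add: place_Suc)

text \<open>A place not owned by \<open>p 0\<close> copies its radix from an earlier one. For a
  later place \<open>h\<close> of \<open>p 0\<close>, dilation by \<open>g 0\<close> leads to a
  place \<open>k > h\<close>, so \<open>g h\<close> divides \<open>g 0\<close>. If they differed,
  \<open>g h * g (Suc h)\<close> would divide \<open>g 0\<close> as well, while place
  \<open>Suc h\<close> copies its radix from some \<open>m \<le> h\<close>; both
  \<open>m = h\<close> and \<open>m < h\<close> are refuted.\<close>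

lemma base_const: "g h = g 0"
proof (induction h rule: less_induct)
  case (less h)
  show ?case
  proof (cases "p h = p 0 \<and> h \<noteq> 0")
    case False
    then show ?thesis using from_owner_less[of h] less by metis
  next
    case True
    \<comment> \<open>The owner of place 1 is dilated by \<open>g 0\<close>; compare its place value \<open>g 0 * place g h\<close>
      with the places following \<open>h\<close>.\<close>
    obtain k where k: "p k = p 1" "place g k = g 0 * place g h"
      using to_owner[of h "p 1"] True c_owner_1 by metis
    have "place g h < place g k" using k(2) base_ge2[of 0] by simp
    then have hk: "Suc h \<le> k" by simp
    then have "place g (Suc h) dvd g 0 * place g h" using k(2) place_dvd by metis
    then have "g h dvd g 0" using place_pos[of h] by (simp add: place_Suc mult.commute)
    show ?thesis
    proof (rule ccontr)
      assume ne: "g h \<noteq> g 0"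
      \<comment> \<open>\<open>k = Suc h\<close> would mean \<open>g h = g 0\<close>, so
        \<open>k\<close> is at least \<open>Suc (Suc h)\<close>.\<close>
      have "k \<noteq> Suc h" using k ne place_pos[of h] by (auto simp: place_Suc)
      with hk have "place g (Suc (Suc h)) dvd g 0 * place g h"
        using k(2) place_dvd[of "Suc (Suc h)" k] by simp
      then have dvd: "g h * g (Suc h) dvd g 0"
        using place_pos[of h] by (simp add: place_Suc mult.commute mult.left_commute)
      obtain m where m: "m < Suc h" "place g (Suc h) = c (p (Suc h)) * place g m" "g (Suc h) = g m"
        using from_owner_less[of "Suc h"] alternating[of h] True by metis
      show False
      proof (cases "m = h")
        case True
        \<comment> \<open>As a dilation factor, \<open>g h\<close> would be a place value strictly
          between \<open>place g 0 = 1\<close> and \<open>place g 1 = g 0\<close>.\<close>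
        then have "c (p (Suc h)) = g h" using m(2) place_pos[of h] by (simp add: place_Suc)
        then obtain n where n: "g h = place g n" using c_is_place by metis
        have "g h < g 0" using \<open>g h dvd g 0\<close> ne by (simp add: dvd_imp_le le_neq_implies_less)
        then have "place g n < place g 1" using n by (simp add: place_Suc)
        then have "n = 0" by simp
        then show False using n base_ge2[of h] by simp
      next
        case False
        then have "g (Suc h) = g 0" using m(1,3) less.IH[of m] by linarith
        then show False using dvd base_ge2[of h] base_pos[of 0] by (simp del: base_pos)
      qed
    qed
  qed
qed

lemma g_eq: "g = (\<lambda>_. g 0)"
  using base_const by blast

lemma place_eq: "place g h = g 0 ^ h"
  by (subst g_eq) simp

lemma c_is_power: "\<exists>k. p k = i \<and> c i = g 0 ^ k"
  using c_is_place place_eq by simp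

end

subsection \<open>Representations by enumerations\<close>

text \<open>Partial sums that converge in a discrete space are eventually constant, and two equal
  consecutive ones make the term between them 0.\<close>

lemma nat_sums_iff:
  fixes f :: "nat \<Rightarrow> nat"
  shows "f sums n \<longleftrightarrow> finite {j. f j \<noteq> 0} \<and> (\<Sum>j | f j \<noteq> 0. f j) = n"
proof
  assume f: "f sums n"
  then have "eventually (\<lambda>k. (\<Sum>j<k. f j) = n) sequentially"
    unfolding sums_def by (simp add: tendsto_discrete)
  then obtain K where K: "\<And>k. K \<le> k \<Longrightarrow> (\<Sum>j<k. f j) = n"
    unfolding eventually_sequentially by blast
  have "f j = 0" if "K \<le> j" for j
    using K[of j] K[of "Suc j"] that by simp
  then have sub: "{j. f j \<noteq> 0} \<subseteq> {..<K}" by (metis (mono_tags, lifting) lessThan_iff linorder_not_le mem_Collect_eq subsetI)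
  then have fin: "finite {j. f j \<noteq> 0}" by (rule finite_subset) simp
  have "f sums (\<Sum>j | f j \<noteq> 0. f j)" by (rule sums_finite[OF fin]) simp
  with f fin show "finite {j. f j \<noteq> 0} \<and> (\<Sum>j | f j \<noteq> 0. f j) = n"
    using sums_unique2 by blast
next
  assume f: "finite {j. f j \<noteq> 0} \<and> (\<Sum>j | f j \<noteq> 0. f j) = n"
  have "f sums (\<Sum>j | f j \<noteq> 0. f j)" by (rule sums_finite[OF conjunct1[OF f]]) simp
  then show "f sums n" unfolding conjunct2[OF f] .
qed

text \<open>The vector of summands \<open>X i\<close> determines \<open>i\<close>, because elements
  of \<open>L\<close> are positive and \<open>enumerate A\<close> is injective; and every
  representation by members of the dilates has this form.\<close>

lemma unique_representation_iff:
  assumes "infinite L" "\<forall>x\<in>L. 1 \<le> x" "infinite A"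
  shows "unique_representation L A \<longleftrightarrow> additive_system (\<lambda>j. (*) (enumerate L j) ` A)"
proof -
  let ?F = "\<lambda>j. (*) (enumerate L j) ` A"
  define X where "X i j = enumerate L j * enumerate A (i j)" for i j
  have pos: "0 < enumerate L j" for j
    using enumerate_in_set[OF assms(1), of j] assms(2) by fastforce
  have rep: "(\<lambda>j. enumerate L j * enumerate A (i j)) sums n \<longleftrightarrow> represents ?F n (X i)" for i n
    unfolding nat_sums_iff represents_def X_def
    using enumerate_in_set[OF assms(3)] by blast
  have inj: "i = i'" if "X i = X i'" for i i'
  proof
    fix j
    have "enumerate A (i j) = enumerate A (i' j)"
      using fun_cong[OF that, of j] pos[of j] by (simp add: X_def)
    then show "i j = i' j" using inj_enumerate[OF assms(3)] by (simp add: inj_def)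
  qed
  have surj: "\<exists>i. x = X i" if x: "represents ?F n x" for n x
  proof -
    have "\<exists>m. x j = enumerate L j * enumerate A m" for j
    proof -
      have "x j \<in> ?F j" using x unfolding represents_def by blast
      then obtain a where "a \<in> A" "x j = enumerate L j * a" by blast
      moreover obtain m where "a = enumerate A m"
        using enumerate_Ex[OF assms(3) \<open>a \<in> A\<close>] by metis
      ultimately show ?thesis by blast
    qed
    then obtain i where "\<And>j. x j = enumerate L j * enumerate A (i j)" by metis
    then show ?thesis unfolding X_def by blast
  qed
  have iff: "(\<exists>!i. represents ?F n (X i)) \<longleftrightarrow> (\<exists>!x. represents ?F n x)" for n
  proof
    assume "\<exists>!i. represents ?F n (X i)"
    then obtain i where i: "represents ?F n (X i)" and eq: "\<And>i'. represents ?F n (X i') \<Longrightarrow> i' = i"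
      by blast
    show "\<exists>!x. represents ?F n x"
    proof (rule ex1I[of _ "X i"])
      fix x assume x: "represents ?F n x"
      then obtain i' where "x = X i'" using surj by blast
      with x eq show "x = X i" by blast
    qed (rule i)
  next
    assume "\<exists>!x. represents ?F n x"
    then obtain x where x: "represents ?F n x" and eq: "\<And>y. represents ?F n y \<Longrightarrow> y = x"
      by blast
    obtain i where i: "x = X i" using surj[OF x] by blast
    show "\<exists>!i. represents ?F n (X i)"
    proof (rule ex1I[of _ i])
      show "represents ?F n (X i)" using x i by simp
      show "i' = i" if "represents ?F n (X i')" for i'
        using inj eq[OF that] i by simp
    qed
  qed
  show ?thesis by (simp only: unique_representation_def additive_system_def rep iff)
qed

subsection \<open>The sets S, T and A as digit families\<close>

text \<open>The radices in the order \<open>u 1, v 1, u 2, v 2, ...\<close>, counted from place 0: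
  even places serve \<open>S\<close>, odd ones \<open>T\<close>.\<close>

definition interleave :: "(nat \<Rightarrow> nat) \<Rightarrow> (nat \<Rightarrow> nat) \<Rightarrow> nat \<Rightarrow> nat" where
  "interleave u v h = (if even h then u (h div 2 + 1) else v (h div 2 + 1))"

lemma initial_prod_Suc: "initial_prod u (Suc h) = initial_prod u h * u (Suc h)"
  by (simp add: initial_prod_def)

lemma place_interleave:
  "place (interleave u v) (2 * h) = initial_prod u h * initial_prod v h"
  "place (interleave u v) (Suc (2 * h)) = initial_prod u (Suc h) * initial_prod v h"
proof -
  show *: "place (interleave u v) (2 * h) = initial_prod u h * initial_prod v h"
  proof (induction h)
    case 0
    then show ?case by (simp add: initial_prod_def)
  next
    case (Suc h)
    then show ?case
      by (simp add: place_Suc interleave_def initial_prod_Suc mult.assoc mult.left_commute)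
  qed
  show "place (interleave u v) (Suc (2 * h)) = initial_prod u (Suc h) * initial_prod v h"
    unfolding place_Suc * by (simp add: interleave_def initial_prod_Suc)
qed

lemma sum_lessThan_double:
  fixes f :: "nat \<Rightarrow> nat"
  shows "(\<Sum>h<2 * k. f h) = (\<Sum>h<k. f (2 * h) + f (Suc (2 * h)))"
  by (induction k) auto

text \<open>The predicate \<open>even\<close> acts as an owner map into \<open>bool\<close>;
  \<open>c\<close> shifts from the even to the odd places.\<close>

lemma (in radix) digit_family_even:
  fixes b :: bool
  defines "c \<equiv> if b then 0 else 1"
  shows "digit_family g even b =
    (\<Union>k\<in>{1..}. {\<Sum>h<k. i h * place g (2 * h + c) | i. \<forall>h<k. i h < g (2 * h + c)})"
proof (intro set_eqI iffI)
  fix x assume x: "x \<in> digit_family g even b"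
  \<comment> \<open>\<open>Suc x\<close> is positive, as the union demands, and \<open>x\<close>
    fits into twice as many places.\<close>
  define k where "k = Suc x"
  have "2 * k = k + k" by simp
  then have "x < place g (2 * k)" using less_place[of "2 * k"] unfolding k_def by linarith
  then have "x = (\<Sum>h<2 * k. digit g h x * place g h)" by (rule expansion[symmetric])
  also have "\<dots> = (\<Sum>h<k. digit g (2 * h + c) x * place g (2 * h + c))"
    unfolding sum_lessThan_double
    by (rule sum.cong) (use x in \<open>auto simp: c_def digit_family_def\<close>)
  finally have "\<exists>i. x = (\<Sum>h<k. i h * place g (2 * h + c)) \<and> (\<forall>h<k. i h < g (2 * h + c))"
    by (intro exI[of _ "\<lambda>h. digit g (2 * h + c) x"]) (simp add: digit_less)
  moreover have "k \<in> {1..}" by (simp add: k_def)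
  ultimately show "x \<in> (\<Union>k\<in>{1..}. {\<Sum>h<k. i h * place g (2 * h + c) | i. \<forall>h<k. i h < g (2 * h + c)})"
    by blast
next
  fix x
  assume "x \<in> (\<Union>k\<in>{1..}. {\<Sum>h<k. i h * place g (2 * h + c) | i. \<forall>h<k. i h < g (2 * h + c)})"
  then obtain k i where x: "x = (\<Sum>h<k. i h * place g (2 * h + c))"
    and i: "\<And>h. h < k \<Longrightarrow> i h < g (2 * h + c)" by blast
  define d where "d h = (if even h = b then i (h div 2) else 0)" for h
  have "x = (\<Sum>h<2 * k. d h * place g h)"
    unfolding sum_lessThan_double x by (rule sum.cong) (auto simp: d_def c_def)
  also have "\<dots> \<in> digit_family g even b"
  proof (rule sum_in_digit_family)
    fix h assume h: "h < 2 * k"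
    show "d h < g h"
    proof (cases "even h = b")
      case True
      then have "h = 2 * (h div 2) + c" by (auto simp: c_def)
      moreover have "h div 2 < k" using h by linarith
      ultimately show ?thesis using i[of "h div 2"] True by (simp add: d_def)
    qed (simp add: d_def)
  qed (auto simp: d_def)
  finally show "x \<in> digit_family g even b" .
qed

lemma S_inf_eq:
  assumes "radix (interleave u v)"
  shows "S_inf u v = digit_family (interleave u v) even True"
  unfolding radix.digit_family_even[OF assms] S_inf_def S_fin_def
  by (simp add: place_interleave interleave_def mult.assoc)

lemma T_inf_eq:
  assumes "radix (interleave u v)"
  shows "T_inf u v = digit_family (interleave u v) even False"
  unfolding radix.digit_family_even[OF assms] T_inf_def T_fin_def
  by (simp add: place_interleave interleave_def mult.assoc)

lemma radix_interleave:
  assumes "\<forall>i\<ge>1. 2 \<le> u i \<and> 2 \<le> v i" shows "radix (interleave u v)"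
  by standard (use assms in \<open>simp add: interleave_def\<close>)

lemma radix_const: "2 \<le> l \<Longrightarrow> radix (\<lambda>_. l)"
  by standard

text \<open>The \<open>\<delta>\<close> are base \<open>l\<close> digits. The owner map stays
  general to cover both the owners in a given system and plain membership in
  \<open>T\<close>.\<close>

lemma A_set_eq:
  assumes l: "2 \<le> l" and T: "T_inf u v = {h. p h = i}"
  shows "A_set l u v = digit_family (\<lambda>_. l) p i"
proof (intro set_eqI iffI)
  interpret radix "\<lambda>_. l" by (rule radix_const[OF l])
  fix x
  {
    assume "x \<in> A_set l u v"
    then obtain \<delta> where x: "x = (\<Sum>t\<in>{t \<in> T_inf u v. \<delta> t \<noteq> 0}. \<delta> t * l ^ t)"
      and less: "\<And>t. t \<in> T_inf u v \<Longrightarrow> \<delta> t < l" and fin: "finite {t \<in> T_inf u v. \<delta> t \<noteq> 0}"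
      unfolding A_set_def by blast
    obtain n where n: "{t \<in> T_inf u v. \<delta> t \<noteq> 0} \<subseteq> {..<n}"
      using fin finite_nat_iff_bounded by blast
    \<comment> \<open>\<open>\<delta>\<close> is unconstrained outside \<open>T\<close>, so its
      values there are replaced by 0.\<close>
    define d where "d t = (if t \<in> T_inf u v then \<delta> t else 0)" for t
    have "(\<Sum>t\<in>{t \<in> T_inf u v. \<delta> t \<noteq> 0}. \<delta> t * l ^ t)
        = (\<Sum>t\<in>{t \<in> T_inf u v. \<delta> t \<noteq> 0}. d t * l ^ t)"
      by (rule sum.cong) (auto simp: d_def)
    also have "\<dots> = (\<Sum>t<n. d t * l ^ t)"
      by (rule sum.mono_neutral_left[OF _ n]) (auto simp: d_def)
    finally have "x = (\<Sum>t<n. d t * place (\<lambda>_. l) t)" using x by simp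
    also have "\<dots> \<in> digit_family (\<lambda>_. l) p i"
      by (rule sum_in_digit_family) (use less l T in \<open>auto simp: d_def\<close>)
    finally show "x \<in> digit_family (\<lambda>_. l) p i" .
  next
    assume x: "x \<in> digit_family (\<lambda>_. l) p i"
    define \<delta> where "\<delta> t = digit (\<lambda>_. l) t x" for t
    have "{t \<in> T_inf u v. \<delta> t \<noteq> 0} \<subseteq> {..<x}"
      using digit_eq_0[OF less_place] unfolding \<delta>_def by (auto simp: not_less intro: ccontr)
    note fin = this finite_subset[OF this finite_lessThan]
    have "x = (\<Sum>t<x. \<delta> t * place (\<lambda>_. l) t)"
      unfolding \<delta>_def by (rule expansion[OF less_place, symmetric])
    also have "\<dots> = (\<Sum>t\<in>{t \<in> T_inf u v. \<delta> t \<noteq> 0}. \<delta> t * l ^ t)"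
      unfolding place_const
      by (rule sum.mono_neutral_right[OF _ fin(1)])
        (use x in \<open>auto simp: T \<delta>_def digit_family_def\<close>)
    finally have "\<exists>\<delta>. x = (\<Sum>t\<in>{t \<in> T_inf u v. \<delta> t \<noteq> 0}. \<delta> t * l ^ t) \<and>
        (\<forall>t\<in>T_inf u v. \<delta> t < l) \<and> finite {t \<in> T_inf u v. \<delta> t \<noteq> 0}"
      using fin(2) digit_less by (intro exI[of _ \<delta>]) (simp add: \<delta>_def)
    then show "x \<in> A_set l u v" by (simp only: A_set_def mem_Collect_eq)
  }
qed

subsection \<open>Complementing pairs\<close>

lemma represents_bool:
  fixes F :: "bool \<Rightarrow> nat set"
  shows "represents F n x \<longleftrightarrow> x True \<in> F True \<and> x False \<in> F False \<and> x True + x False = n"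
proof -
  have "(\<Sum>i | x i \<noteq> 0. x i) = sum x UNIV" by (rule sum.mono_neutral_left) auto
  then show ?thesis unfolding represents_def by (auto simp: UNIV_bool all_bool_eq)
qed

lemma additive_system_boolI:
  fixes F :: "bool \<Rightarrow> nat set"
  assumes ex: "\<And>n. \<exists>s\<in>F True. \<exists>t\<in>F False. n = s + t"
    and uniq: "\<And>s t s' t'. \<lbrakk>s \<in> F True; t \<in> F False; s' \<in> F True; t' \<in> F False; s + t = s' + t'\<rbrakk>
      \<Longrightarrow> s = s' \<and> t = t'"
  shows "additive_system F"
  unfolding additive_system_def represents_bool
proof (intro allI ex_ex1I)
  fix n
  obtain s t where "s \<in> F True" "t \<in> F False" "n = s + t" using ex by blast
  then show "\<exists>x. x True \<in> F True \<and> x False \<in> F False \<and> x True + x False = n"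
    by (intro exI[of _ "case_bool s t"]) simp
next
  fix n x y
  assume "x True \<in> F True \<and> x False \<in> F False \<and> x True + x False = n"
    and "y True \<in> F True \<and> y False \<in> F False \<and> y True + y False = n"
  then have "x True = y True \<and> x False = y False" by (intro uniq) auto
  then show "x = y" by (auto simp: fun_eq_iff all_bool_eq)
qed

lemma additive_system_boolD:
  fixes F :: "bool \<Rightarrow> nat set"
  assumes "additive_system F"
  shows "\<exists>s\<in>F True. \<exists>t\<in>F False. n = s + t"
    and "\<lbrakk>s \<in> F True; t \<in> F False; s' \<in> F True; t' \<in> F False; s + t = s' + t'\<rbrakk>
      \<Longrightarrow> s = s' \<and> t = t'"
proof -
  obtain x where "represents F n x" using additive_systemD(1)[OF assms] by blast
  then show "\<exists>s\<in>F True. \<exists>t\<in>F False. n = s + t" unfolding represents_bool by blast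
next
  assume st: "s \<in> F True" "t \<in> F False" "s' \<in> F True" "t' \<in> F False" "s + t = s' + t'"
  have "case_bool s t = case_bool s' t'"
    by (rule additive_systemD(2)[OF assms, of "s + t"]) (use st in \<open>simp_all add: represents_bool\<close>)
  from fun_cong[OF this, of True] fun_cong[OF this, of False] show "s = s' \<and> t = t'" by simp
qed

context dilates
begin

lemma infinite_owner_places:
  assumes "infinite A" shows "infinite {h. p h = p 0}"
proof
  assume "finite {h. p h = p 0}"
  then obtain k where k: "{h. p h = p 0} \<subseteq> {..<k}" using finite_nat_iff_bounded by blast
  have "A \<subseteq> {..<place g k}"
  proof
    fix x assume "x \<in> A"
    then have x: "x \<in> digit_family g p (p 0)" by (simp flip: A_eq)
    have "digit g h x = 0" if "k \<le> h" for h
    proof -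
      have "p h \<noteq> p 0" using k that by auto
      then show ?thesis using x by (simp add: digit_family_def)
    qed
    then show "x \<in> {..<place g k}" using digit_eq_0_conv by blast
  qed
  then show False using assms finite_subset by blast
qed

text \<open>Passing to exponents turns dilation into translation. Place \<open>n\<close> arises from
  a place \<open>h\<close> of \<open>p 0\<close> by the factor of its owner, so \<open>n\<close> is
  an exponent plus \<open>h\<close>; and the owner of place \<open>s + t\<close> determines the
  factor \<open>g 0 ^ s\<close>, hence \<open>s\<close> and \<open>t\<close>.\<close>

lemma complementing_pair:
  "additive_system (case_bool {s. g 0 ^ s \<in> range c} {h. p h = p 0})"
proof (rule additive_system_boolI; simp only: bool.case mem_Collect_eq)
  fix n
  obtain h where h: "p h = p 0" "place g n = c (p n) * place g h" using from_owner by blast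
  obtain k where k: "c (p n) = g 0 ^ k" using c_is_power by blast
  have "place g n = place g (k + h)" using h(2) unfolding k place_eq power_add .
  then have "n = k + h" by simp
  moreover have "k \<in> {s. g 0 ^ s \<in> range c}" unfolding mem_Collect_eq k[symmetric] by (rule rangeI)
  moreover have "h \<in> {h. p h = p 0}" using h(1) by simp
  ultimately show "\<exists>s\<in>{s. g 0 ^ s \<in> range c}. \<exists>t\<in>{h. p h = p 0}. n = s + t" by blast
next
  fix s t s' t'
  assume "g 0 ^ s \<in> range c" "p t = p 0" "g 0 ^ s' \<in> range c" "p t' = p 0" and eq: "s + t = s' + t'"
  then obtain i i' where i: "g 0 ^ s = c i" "g 0 ^ s' = c i'" by blast
  have owner: "p (s + t) = i" if "g 0 ^ s = c i" "p t = p 0" for s t i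
  proof -
    obtain k where k: "p k = i" "place g k = c i * place g t" using to_owner \<open>p t = p 0\<close> by blast
    have "place g k = place g (s + t)" using k(2) unfolding that(1)[symmetric] place_eq power_add .
    with k(1) show ?thesis by simp
  qed
  have "i = i'" using owner[OF i(1) \<open>p t = p 0\<close>] owner[OF i(2) \<open>p t' = p 0\<close>] eq by simp
  then have "place g s = place g s'" unfolding place_eq using i by simp
  then show "s = s' \<and> t = t'" using eq by simp
qed

text \<open>\<open>S\<close> is infinite because the injective \<open>c\<close> has infinitely many
  values, \<open>T\<close> because \<open>A\<close> is infinite. So the structure theorem applies to
  the pair; its radices, taken alternately, are \<open>u\<close> and \<open>v\<close>.\<close>

lemma pair_of_interleaved_sequences:
  assumes inf: "infinite A" "infinite (UNIV :: 'i set)"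
  obtains u v where "\<forall>i\<ge>1. 2 \<le> u i \<and> 2 \<le> v i"
    "range c = Lambda_set (g 0) u v" "A = A_set (g 0) u v"
proof -
  define S where "S = {s. g 0 ^ s \<in> range c}"
  define T where "T = {h. p h = p 0}"
  have add: "additive_system (case_bool S T)"
    using complementing_pair unfolding S_def T_def .
  have range_c: "range c = (\<lambda>s. g 0 ^ s) ` S"
  proof (intro equalityI subsetI)
    fix x assume x: "x \<in> range c"
    then obtain k where k: "x = g 0 ^ k" using c_is_power by blast
    with x have "k \<in> S" by (simp add: S_def)
    with k show "x \<in> (\<lambda>s. g 0 ^ s) ` S" by (rule image_eqI)
  qed (auto simp: S_def)
  have "infinite (range c)" using c_inj inf(2) finite_imageD by blast
  then have "infinite S" unfolding range_c by blast
  moreover have "infinite T" unfolding T_def by (rule infinite_owner_places[OF inf(1)])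
  ultimately have "infinite (case_bool S T b)" for b by (cases b) simp_all
  then obtain b q where b: "radix b" and q: "\<And>h. q (Suc h) \<noteq> q h"
    and fam: "case_bool S T = digit_family b q"
    using additive_system_structure[of "case_bool S T" True False] add by blast
  \<comment> \<open>The owner of place 1 is dilated by \<open>g 0\<close>, so \<open>S\<close>
    contains 1 and owns the first place of the new numeration, whose radix is to be
    \<open>u 1\<close>.\<close>
  have "g 0 ^ 1 = c (p 1)" using c_owner_1 by simp
  then have "1 \<in> S" unfolding S_def mem_Collect_eq by (rule range_eqI)
  then have "1 \<in> digit_family b q True" by (simp flip: fam)
  moreover have "1 \<in> digit_family b q (q 0)"
    using radix.digit_place[OF b, of _ 0] by (auto simp: digit_family_def)
  ultimately have "q 0 = True"
    using additive_system_disjoint[OF radix.additive_system_digit_family[OF b]]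
    by (metis zero_neq_one)
  \<comment> \<open>With only two owners, never equal at consecutive places, ownership is
    parity.\<close>
  then have "q h = even h" for h by (induction h) (use q in auto)
  then have "q = even" by blast
  define u where "u i = b (2 * (i - 1))" for i
  define v where "v i = b (2 * (i - 1) + 1)" for i
  have "interleave u v = b"
    by (rule ext) (simp add: interleave_def u_def v_def)
  then have ST: "S_inf u v = S" "T_inf u v = T"
    using S_inf_eq[of u v] T_inf_eq[of u v] b
    by (simp_all flip: fam \<open>q = even\<close>)
  have "\<forall>i\<ge>1. 2 \<le> u i \<and> 2 \<le> v i"
    using radix.base_ge2[OF b] by (simp add: u_def v_def)
  moreover have "range c = Lambda_set (g 0) u v"
    unfolding range_c Lambda_set_def ST by blast
  moreover have "A = A_set (g 0) u v"
    using A_set_eq[OF base_ge2[of 0] ST(2)[unfolded T_def]] unfolding A_eq g_eq[symmetric] by simp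
  ultimately show thesis by (rule that)
qed

end

section \<open>The converse: an additive system from a complementing pair of exponents\<close>

lemma (in radix) digit_family_place_multiple:
  assumes "\<And>h. h < s \<Longrightarrow> digit g h x = 0" shows "place g s dvd x"
  using digit_expansion[of x g s] assms by (metis (no_types, lifting) add_0 dvd_triv_left lessThan_iff mult_zero_left sum.neutral)

lemma digit_const_shift:
  assumes "0 < l"
  shows "digit (\<lambda>_. l) h (l ^ s * a) = (if h < s then 0 else digit (\<lambda>_. l) (h - s) a)"
proof (cases "h < s")
  case True
  then have "l ^ s * a = l ^ h * (l * (l ^ (s - h - 1) * a))"
    by (simp flip: power_add power_Suc mult.assoc)
  then have "l ^ s * a div l ^ h = l * (l ^ (s - h - 1) * a)"
    using nonzero_mult_div_cancel_left[of "l ^ h"] assms by (metis less_irrefl power_not_zero)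
  then show ?thesis using True by (simp add: digit_def)
next
  case False
  then have "l ^ h = l ^ s * l ^ (h - s)" by (simp flip: power_add)
  then show ?thesis using False assms by (simp add: digit_def)
qed

text \<open>In base \<open>l\<close>, multiplication by \<open>l ^ s\<close> shifts digits by
  \<open>s\<close> places, so this dilate of \<open>A\<close> uses exactly the places
  \<open>s + t\<close> with \<open>t \<in> T\<close>. Since every place is uniquely such a sum, the
  dilates form a digit family.\<close>

lemma dilates_additive_system:
  assumes l: "2 \<le> l" and ST: "additive_system (case_bool S T)"
    and A: "A = digit_family (\<lambda>_. l) (\<lambda>h. h \<in> T) True"
    and e: "inj e" "range e = (\<lambda>s. l ^ s) ` S"
  shows "additive_system (\<lambda>j. (*) (e j) ` A)"
proof -
  interpret radix "\<lambda>_. l" by (rule radix_const[OF l])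
  have pow: "l ^ s = l ^ s' \<longleftrightarrow> s = s'" for s s' using l by simp
  note ex = additive_system_boolD(1)[OF ST, simplified]
  note uniq = additive_system_boolD(2)[OF ST, simplified]
  \<comment> \<open>Place \<open>s + t\<close> is owned by the member dilated by \<open>l ^ s\<close>.\<close>
  define P where "P h j \<longleftrightarrow> (\<exists>s\<in>S. \<exists>t\<in>T. h = s + t \<and> e j = l ^ s)" for h j
  have "\<exists>!j. P h j" for h
  proof -
    obtain s t where st: "s \<in> S" "t \<in> T" "h = s + t" using ex by blast
    obtain j where j: "e j = l ^ s" using e(2) st(1) by (metis imageE imageI)
    have "j' = j" if Pj': "P h j'" for j'
    proof -
      obtain s' t' where "s' \<in> S" "t' \<in> T" "h = s' + t'" "e j' = l ^ s'" using Pj' unfolding P_def by blast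
      then have "e j' = e j" using uniq[of s t s' t'] st j by simp
      then show ?thesis using e(1) by (simp add: inj_eq)
    qed
    moreover have "P h j" using st j unfolding P_def by blast
    ultimately show ?thesis by blast
  qed
  then obtain p where p: "\<And>h j. P h j \<longleftrightarrow> p h = j" by metis
  have "(*) (e j) ` A = digit_family (\<lambda>_. l) p j" for j
  proof -
    obtain s where s: "s \<in> S" "e j = l ^ s" using e(2) by (metis imageE rangeI)
    have ph: "p h = j \<longleftrightarrow> (\<exists>t\<in>T. h = s + t)" for h
      unfolding p[symmetric] P_def using s pow by auto
    show ?thesis
    proof (intro equalityI subsetI)
      fix x assume "x \<in> (*) (e j) ` A"
      then obtain a where a: "a \<in> A" "x = l ^ s * a" using s by auto
      have "digit (\<lambda>_. l) h x = 0" if "p h \<noteq> j" for h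
      proof (cases "h < s")
        case False
        then have "h - s \<notin> T" using that ph[of h] by auto
        then show ?thesis using a l False unfolding A by (simp add: digit_const_shift digit_family_def)
      qed (use a l in \<open>simp add: digit_const_shift\<close>)
      then show "x \<in> digit_family (\<lambda>_. l) p j" by (simp add: digit_family_def)
    next
      fix x assume x: "x \<in> digit_family (\<lambda>_. l) p j"
      \<comment> \<open>No place below \<open>s\<close> has the form \<open>s + t\<close>, so the
        low digits vanish and \<open>l ^ s\<close> can be divided out.\<close>
      have "digit (\<lambda>_. l) h x = 0" if "h < s" for h
        using x ph[of h] that by (auto simp: digit_family_def)
      from digit_family_place_multiple[OF this] obtain a where a: "x = l ^ s * a" by (auto elim: dvdE)
      have "digit (\<lambda>_. l) h a = 0" if "h \<notin> T" for h
      proof -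
        have "p (s + h) \<noteq> j" using ph[of "s + h"] that by auto
        then have "digit (\<lambda>_. l) (s + h) x = 0" using x by (simp add: digit_family_def)
        then show ?thesis using l unfolding a by (simp add: digit_const_shift)
      qed
      then have "a \<in> A" unfolding A by (simp add: digit_family_def)
      then show "x \<in> (*) (e j) ` A" unfolding a s(2) by (rule imageI)
    qed
  qed
  then show ?thesis using additive_system_digit_family[of p] by simp
qed

theorem theorem1p2:
  fixes L A :: "nat set"
  assumes "infinite L" and "\<forall>x\<in>L. 1 \<le> x"
    and "infinite A"
  shows "unique_representation L A \<longleftrightarrow>
    (\<exists>(l::nat) (u::nat \<Rightarrow> nat) (v::nat \<Rightarrow> nat).
        2 \<le> l \<and> (\<forall>i\<ge>1. 2 \<le> u i \<and> 2 \<le> v i) \<and>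
        L = Lambda_set l u v \<and> A = A_set l u v)"
proof -
  let ?e = "enumerate L"
  have pos: "0 < ?e j" for j
    using enumerate_in_set[OF assms(1), of j] assms(2) by fastforce
  have inj: "inj ?e" by (rule inj_enumerate[OF assms(1)])
  have range: "range ?e = L" by (rule range_enumerate[OF assms(1)])
  show ?thesis
    unfolding unique_representation_iff[OF assms]
  proof
    let ?F = "\<lambda>j. (*) (?e j) ` A"
    assume F: "additive_system ?F"
    have inf: "infinite (?F j)" for j
      using assms(3) pos[of j] finite_imageD[of "(*) (?e j)" A] by (auto simp: inj_on_def)
    \<comment> \<open>The indices 0 and 1 are the two distinct members that the structure theorem
      asks for.\<close>
    obtain g p where g: "radix g" "\<And>h. p (Suc h) \<noteq> p h" "?F = digit_family g p"
      using additive_system_structure[OF F inf, of 0 1] by auto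
    interpret dilates g p ?e A
      using g pos inj by (intro dilates.intro alternating_radix.intro
          alternating_radix_axioms.intro dilates_axioms.intro) (auto dest: fun_cong)
    obtain u v where "\<forall>i\<ge>1. 2 \<le> u i \<and> 2 \<le> v i" "range ?e = Lambda_set (g 0) u v" "A = A_set (g 0) u v"
      using pair_of_interleaved_sequences[OF assms(3) infinite_UNIV_nat] by blast
    then show "\<exists>l u v. 2 \<le> l \<and> (\<forall>i\<ge>1. 2 \<le> u i \<and> 2 \<le> v i) \<and>
        L = Lambda_set l u v \<and> A = A_set l u v"
      using base_ge2[of 0] range by auto
  next
    assume "\<exists>l u v. 2 \<le> l \<and> (\<forall>i\<ge>1. 2 \<le> u i \<and> 2 \<le> v i) \<and>
        L = Lambda_set l u v \<and> A = A_set l u v"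
    then obtain l u v where l: "2 \<le> l" and uv: "\<forall>i\<ge>1. 2 \<le> u i \<and> 2 \<le> v i"
      and L: "L = Lambda_set l u v" and A: "A = A_set l u v" by blast
    note radix = radix_interleave[OF uv]
    have "digit_family (interleave u v) even = case_bool (S_inf u v) (T_inf u v)"
      by (rule ext) (simp add: S_inf_eq[OF radix] T_inf_eq[OF radix] split: bool.split)
    then have "additive_system (case_bool (S_inf u v) (T_inf u v))"
      using radix.additive_system_digit_family[OF radix, of even] by simp
    \<comment> \<open>Membership in \<open>T\<close> serves as a \<open>bool\<close>-valued owner
      map, with \<open>True\<close> owning the places in \<open>T\<close>.\<close>
    moreover have "A = digit_family (\<lambda>_. l) (\<lambda>h. h \<in> T_inf u v) True"
      unfolding A by (rule A_set_eq[OF l]) simp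
    moreover have "range ?e = (\<lambda>s. l ^ s) ` S_inf u v"
      using range trans[OF L, of "(\<lambda>s. l ^ s) ` S_inf u v"] by (auto simp: Lambda_set_def)
    ultimately show "additive_system (\<lambda>j. (*) (?e j) ` A)"
      using dilates_additive_system[OF l _ _ inj] by blast
  qed
qed

end
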